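(* Let $m>0$ be an integer and let $\Gamma\subset\mathbb Z^2$ be a simply connected lattice region whose boundary is $\partial\Gamma=\alpha\cup\eta_+\cup\eta_-\cup\beta$, where $\alpha\subset\{x=0\}$ and $\beta\subset\{x=m\}$ are vertical intervals, and $\eta_+$ (upper boundary, joining the top endpoint of $\alpha$ to the top endpoint of $\beta$) and $\eta_-$ (lower boundary, joining the bottom endpoint of $\alpha$ to the bottom endpoint of $\beta$) are $x$-monotone lattice paths. Assume the origin $O=(0,0)$ lies in $\alpha$. Let $\{X_t\}$ be the simple (nearest neighbor, each of the four neighbors with probability $1/4$) lattice random walk on $\mathbb Z^2$ started at $X_0=O$, which is absorbed (killed) whenever it tries to step outside $\Gamma$. Let $T$ be the first time $t$ such that $X_t\in\beta$, and for $k\in\mathbb Z$ let $p(k)$ be the probability that $X_T=(m,k)$ (i.e. that the walk reaches $\beta$ before being absorbed, and does so first at the point $(m,k)$). Then $$p(k)^2\ \ge\ p(k+1)\,p(k-1)$$ for all $k\in\mathbb Z$ such that $(m,k+1)\in\beta$ and $(m,k-1)\in\beta$.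
   Context: A lattice path is a sequence of points of $\mathbb Z^2$ in which consecutive points are at Euclidean distance $1$ (it may self-intersect). An $x$-monotone lattice path is one along which the $x$-coordinate is weakly increasing. The region $\Gamma$ consists of the lattice points on and inside the closed curve $\partial\Gamma$.
   Formalization: The formal theorem assumes in addition that β is the whole right side of Γ, i.e. Γ∩{x=m}=β; without this, the upper or lower boundary path could run along x=m beyond β, and the inequality can fail (e.g. in a 2×4 rectangle). *)

theory Defs
  imports "HOL-Probability.Probability"
begin

text \<open>On \<^typ>\<open>int \<times> int\<close> the library's \<^const>\<open>dist\<close> is the Euclidean distance.\<close>

definition lattice_path :: "(int \<times> int) list \<Rightarrow> bool" where
  "lattice_path ps \<longleftrightarrow> ps \<noteq> [] \<and> successively (\<lambda>p q. dist p q = 1) ps"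

definition x_monotone :: "(int \<times> int) list \<Rightarrow> bool" where
  "x_monotone ps \<longleftrightarrow> successively (\<lambda>p q. fst p \<le> fst q) ps"

definition plane_point :: "int \<times> int \<Rightarrow> real \<times> real" where
  "plane_point p = (real_of_int (fst p), real_of_int (snd p))"

definition path_curve :: "(int \<times> int) list \<Rightarrow> (real \<times> real) set" where
  "path_curve ps = plane_point ` set ps \<union>
     (\<Union>(p, q) \<in> set (zip ps (tl ps)). closed_segment (plane_point p) (plane_point q))"

definition vertical_interval :: "int \<Rightarrow> int \<Rightarrow> int \<Rightarrow> (int \<times> int) set" where
  "vertical_interval x c d = {x} \<times> {c..d}"

definition boundary_curve ::
  "int \<Rightarrow> int \<Rightarrow> int \<Rightarrow> int \<Rightarrow> int \<Rightarrow> (int \<times> int) list \<Rightarrow> (int \<times> int) list \<Rightarrow> (real \<times> real) set" where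
  "boundary_curve m a\<^sub>0 a\<^sub>1 b\<^sub>0 b\<^sub>1 \<eta>p \<eta>m =
     closed_segment (plane_point (0, a\<^sub>0)) (plane_point (0, a\<^sub>1)) \<union>
     path_curve \<eta>p \<union> path_curve \<eta>m \<union>
     closed_segment (plane_point (m, b\<^sub>0)) (plane_point (m, b\<^sub>1))"

text \<open>\<^term>\<open>inside C\<close> is the union of the bounded components of the complement of \<^term>\<open>C\<close>.\<close>

definition lattice_region :: "(real \<times> real) set \<Rightarrow> (int \<times> int) set" where
  "lattice_region C = {p. plane_point p \<in> C \<union> inside C}"

definition unit_steps :: "(int \<times> int) set" where
  "unit_steps = {(1, 0), (-1, 0), (0, 1), (0, -1)}"

definition simple_random_walk :: "'a measure \<Rightarrow> int \<times> int \<Rightarrow> (nat \<Rightarrow> 'a \<Rightarrow> int \<times> int) \<Rightarrow> bool" where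
  "simple_random_walk M v X \<longleftrightarrow>
     prob_space M \<and>
     (\<forall>t. X t \<in> measurable M (count_space UNIV)) \<and>
     (AE \<omega> in M. X 0 \<omega> = v) \<and>
     prob_space.indep_vars M (\<lambda>_. count_space UNIV) (\<lambda>t \<omega>. X (Suc t) \<omega> - X t \<omega>) UNIV \<and>
     (\<forall>t. distr M (count_space UNIV) (\<lambda>\<omega>. X (Suc t) \<omega> - X t \<omega>) = measure_pmf (pmf_of_set unit_steps))"

text \<open>The value \<^const>\<open>None\<close> is the cemetery state of the walk killed on leaving \<open>\<Gamma>\<close>.\<close>

definition killed_walk ::
  "(int \<times> int) set \<Rightarrow> (nat \<Rightarrow> 'a \<Rightarrow> int \<times> int) \<Rightarrow> nat \<Rightarrow> 'a \<Rightarrow> (int \<times> int) option" where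
  "killed_walk \<Gamma> X t \<omega> = (if \<forall>s\<le>t. X s \<omega> \<in> \<Gamma> then Some (X t \<omega>) else None)"

definition hit_time :: "(nat \<Rightarrow> 'a \<Rightarrow> 'b option) \<Rightarrow> 'b set \<Rightarrow> 'a \<Rightarrow> enat" where
  "hit_time Y B \<omega> = Inf {enat t |t. Y t \<omega> \<in> Some ` B}"

definition hit_prob :: "'a measure \<Rightarrow> (nat \<Rightarrow> 'a \<Rightarrow> 'b option) \<Rightarrow> 'b set \<Rightarrow> 'b \<Rightarrow> real" where
  "hit_prob M Y B z =
     measure M {\<omega> \<in> space M. \<exists>t. hit_time Y B \<omega> = enat t \<and> Y t \<omega> = Some z}"

end

theory Submission
  imports Defs
begin

text \<open>
  Write \<open>F = \<Gamma> - \<beta>\<close>, a finite set whose columns are intervals, \<open>F' = F + (0, 1)\<close> and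
  \<open>D = F \<union> F'\<close>. Let \<open>c = (m, k)\<close>, \<open>d = (m, k + 1)\<close>, \<open>a = (0, 0)\<close>, \<open>b = (0, 1)\<close>, and let
  \<open>w\<^sub>S, u\<^sub>S\<close> be the probabilities of leaving \<open>S\<close> at \<open>c\<close>, respectively at \<open>d\<close>, as functions of the starting point.
  By translation the claim reads \<open>w\<^sub>F a / u\<^sub>F a \<ge> w\<^sub>F\<^sub>' b / u\<^sub>F\<^sub>' b\<close>, and it splits as
  \<open>w\<^sub>F a / u\<^sub>F a \<ge> w\<^sub>D a / u\<^sub>D a \<ge> w\<^sub>D b / u\<^sub>D b \<ge> w\<^sub>F\<^sub>' b / u\<^sub>F\<^sub>' b\<close>.

  If the middle inequality failed, some combination \<open>h = A w\<^sub>D - B u\<^sub>D\<close> with \<open>A, B \<ge> 0\<close> would satisfy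
  \<open>h a < 0 < h b\<close>. By the minimum principle \<open>a\<close> is then joined to \<open>d\<close> by a walk on which \<open>h < 0\<close>,
  and \<open>b\<close> to \<open>c\<close> by a walk on which \<open>h > 0\<close>; but by planarity these walks share a vertex.
  The same argument with \<open>b\<close> replaced by a point \<open>t\<close> of \<open>D - F\<close>, which is the top of its column, gives
  \<open>w\<^sub>D t / u\<^sub>D t \<le> w\<^sub>D a / u\<^sub>D a\<close>; since the walks counted in \<open>D\<close> but not in \<open>F\<close> pass through such points,
  the first inequality follows. The last one is symmetric.
\<close>

section \<open>Columns of the region\<close>

lemma is_interval_section_convex:
  fixes S :: "(real \<times> real) set"
  assumes "convex S"
  shows "is_interval (Pair x -` S)"
  unfolding is_interval_convex_1
proof (rule convexI)
  fix y z u v :: real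
  assume "y \<in> Pair x -` S" "z \<in> Pair x -` S" and uv: "0 \<le> u" "0 \<le> v" "u + v = 1"
  then have "u *\<^sub>R (x, y) + v *\<^sub>R (x, z) \<in> S"
    using assms by (intro convexD) auto
  moreover have "u * x + v * x = x"
    using uv(3) by (metis distrib_right mult_1)
  ultimately show "u *\<^sub>R y + v *\<^sub>R z \<in> Pair x -` S"
    by simp
qed

lemma closed_segment_same_fst:
  fixes x y z :: real
  shows "closed_segment (x, y) (x, z) = {x} \<times> closed_segment y z"
proof -
  have "(1 - u) * x + u * x = x" for u
    by (simp add: algebra_simps)
  then show ?thesis
    by (auto simp: closed_segment_def)
qed

lemma is_interval_Un:
  fixes I J :: "real set"
  assumes "is_interval I" "is_interval J" "I \<inter> J \<noteq> {}"
  shows "is_interval (I \<union> J)"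
  using assms unfolding is_interval_connected_1 by (intro connected_Un) auto

lemma path_curve_Cons_Cons:
  "path_curve (p # q # ps) =
     closed_segment (plane_point p) (plane_point q) \<union> path_curve (q # ps)"
  by (auto simp: path_curve_def)

lemma path_curve_single [simp]: "path_curve [p] = {plane_point p}"
  by (simp add: path_curve_def)

lemma compact_path_curve: "compact (path_curve ps)"
  unfolding path_curve_def by (rule compact_Un[OF finite_imp_compact compact_UN]) auto

lemma plane_point_in_path_curve: "p \<in> set ps \<Longrightarrow> plane_point p \<in> path_curve ps"
  by (auto simp: path_curve_def)

text \<open>Induction along the path: by monotonicity the first segment and the rest of the curve
  share at most the column of the second vertex. Both contain that vertex, so their sections there
  overlap and unite to an interval.\<close>

lemma path_curve_sections:
  assumes "ps \<noteq> []" "x_monotone ps"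
  shows "is_interval (Pair x -` path_curve ps)"
    and "fst ` path_curve ps = {real_of_int (fst (hd ps))..real_of_int (fst (last ps))}"
proof -
  have "is_interval (Pair x -` path_curve ps) \<and> fst (hd ps) \<le> fst (last ps) \<and>
      fst ` path_curve ps = {real_of_int (fst (hd ps))..real_of_int (fst (last ps))}"
    using assms
  proof (induction ps rule: induct_list012)
    case (2 p)
    have "is_interval (Pair x -` {plane_point p})"
      by (rule is_interval_section_convex) simp
    then show ?case
      by (simp add: plane_point_def)
  next
    case (3 p q ps)
    let ?S = "closed_segment (plane_point p) (plane_point q)"
    let ?T = "path_curve (q # ps)"
    have pq: "fst p \<le> fst q" and "x_monotone (q # ps)"
      using 3 by (auto simp: x_monotone_def)
    then have IH: "is_interval (Pair x -` ?T)" "fst q \<le> fst (last (q # ps))"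
        "fst ` ?T = {real_of_int (fst q)..real_of_int (fst (last (q # ps)))}"
      using 3 by simp_all
    have fS: "fst ` ?S = {real_of_int (fst p)..real_of_int (fst q)}"
      using pq by (simp add: closed_segment_linear_image[symmetric] linear_fst
          closed_segment_eq_real_ivl plane_point_def)
    have qS: "plane_point q \<in> ?S" and qT: "plane_point q \<in> ?T"
      by (auto intro: plane_point_in_path_curve)
    have "is_interval (Pair x -` ?S \<union> Pair x -` ?T)"
    proof (cases "Pair x -` ?S = {} \<or> Pair x -` ?T = {}")
      case True
      then show ?thesis
        using IH(1) is_interval_section_convex[of ?S x] by auto
    next
      case False
      then obtain y z where "(x, y) \<in> ?S" "(x, z) \<in> ?T" by blast
      then have "x \<in> fst ` ?S" "x \<in> fst ` ?T"
        by force+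
      then have "x = fst q"
        using fS IH(3) by auto
      then have "snd (plane_point q) \<in> (Pair x -` ?S) \<inter> (Pair x -` ?T)"
        using qS qT by (simp add: plane_point_def)
      then show ?thesis
        using IH(1) is_interval_section_convex[of ?S x] by (intro is_interval_Un) auto
    qed
    moreover have "fst ` (?S \<union> ?T) =
        {real_of_int (fst p)..real_of_int (fst (last (q # ps)))}"
      unfolding image_Un fS IH(3) using pq IH(2) by (intro ivl_disj_un_two_touch) auto
    ultimately show ?case
      using pq IH(2) unfolding path_curve_Cons_Cons vimage_Un by simp
  qed simp
  then show "is_interval (Pair x -` path_curve ps)"
    and "fst ` path_curve ps = {real_of_int (fst (hd ps))..real_of_int (fst (last ps))}"
    by auto
qed

section \<open>Points enclosed by the boundary curve\<close>

lemma not_inside_if_ray_avoids: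
  fixes C :: "(real \<times> real) set"
  assumes "Ray \<inter> C = {}" "connected Ray" "\<not> bounded Ray" "p \<in> Ray"
  shows "p \<notin> C \<union> inside C"
proof -
  have "Ray \<subseteq> connected_component_set (- C) p"
    using assms by (intro connected_component_maximal) auto
  then have "\<not> bounded (connected_component_set (- C) p)"
    using assms(3) bounded_subset by blast
  then show ?thesis
    using assms by (auto simp: inside_def)
qed

text \<open>The two vertical half-lines from \<open>(x, y)\<close> are connected and unbounded, so
  neither can avoid \<open>C\<close>.\<close>

lemma section_extends_above_below:
  fixes C :: "(real \<times> real) set"
  assumes "(x, y) \<in> C \<union> inside C"
  obtains u v where "u \<le> y" "(x, u) \<in> C" "y \<le> v" "(x, v) \<in> C"
proof -
  have unb: "\<not> bounded ({x} \<times> {y..})" "\<not> bounded ({x} \<times> {..y})"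
  proof -
    have "\<exists>q\<in>{x} \<times> {y..}. B < norm q" for B
      using norm_snd_le[of "y + \<bar>y\<bar> + \<bar>B\<bar> + 1" x]
      by (intro bexI[of _ "(x, y + \<bar>y\<bar> + \<bar>B\<bar> + 1)"]) auto
    moreover have "\<exists>q\<in>{x} \<times> {..y}. B < norm q" for B
      using norm_snd_le[of "y - \<bar>y\<bar> - \<bar>B\<bar> - 1" x]
      by (intro bexI[of _ "(x, y - \<bar>y\<bar> - \<bar>B\<bar> - 1)"]) auto
    ultimately show "\<not> bounded ({x} \<times> {y..})" "\<not> bounded ({x} \<times> {..y})"
      unfolding bounded_iff by (meson not_less)+
  qed
  have "{x} \<times> {y..} \<inter> C \<noteq> {}"
    using not_inside_if_ray_avoids[of "{x} \<times> {y..}" C "(x, y)"] assms unb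
    by (auto intro!: connected_Times)
  moreover have "{x} \<times> {..y} \<inter> C \<noteq> {}"
    using not_inside_if_ray_avoids[of "{x} \<times> {..y}" C "(x, y)"] assms unb
    by (auto intro!: connected_Times)
  ultimately show ?thesis
    using that by blast
qed

text \<open>Each shadow is the Minkowski sum of the compact set \<open>E\<close> and a closed
  vertical half-line.\<close>

lemma closed_vertical_shadow:
  fixes E :: "(real \<times> real) set"
  assumes "compact E"
  shows "closed {q. \<exists>y\<ge>snd q. (fst q, y) \<in> E}" (is "closed ?A")
    and "closed {q. \<exists>y\<le>snd q. (fst q, y) \<in> E}" (is "closed ?B")
proof -
  have "?A = (\<Union>e\<in>E. \<Union>f\<in>{0} \<times> {..0}. {e + f})"
  proof (intro equalityI subsetI)
    fix q assume "q \<in> ?A"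
    then obtain y where "(fst q, y) \<in> E" "(0, snd q - y) \<in> {0} \<times> {..0::real}"
      by auto
    moreover have "q = (fst q, y) + (0, snd q - y)"
      by (simp add: prod_eq_iff)
    ultimately show "q \<in> (\<Union>e\<in>E. \<Union>f\<in>{0} \<times> {..0}. {e + f})"
      by blast
  next
    fix q assume "q \<in> (\<Union>e\<in>E. \<Union>f\<in>{0} \<times> {..0}. {e + f})"
    then obtain e t where "e \<in> E" "q = e + (0, t)" "t \<le> 0"
      by auto
    then have "(fst q, snd e) \<in> E" "snd q \<le> snd e"
      by simp_all
    then show "q \<in> ?A"
      by blast
  qed
  moreover have "?B = (\<Union>e\<in>E. \<Union>f\<in>{0} \<times> {0..}. {e + f})"
  proof (intro equalityI subsetI)
    fix q assume "q \<in> ?B"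
    then obtain y where "(fst q, y) \<in> E" "(0, snd q - y) \<in> {0} \<times> {0::real..}"
      by auto
    moreover have "q = (fst q, y) + (0, snd q - y)"
      by (simp add: prod_eq_iff)
    ultimately show "q \<in> (\<Union>e\<in>E. \<Union>f\<in>{0} \<times> {0..}. {e + f})"
      by blast
  next
    fix q assume "q \<in> (\<Union>e\<in>E. \<Union>f\<in>{0} \<times> {0..}. {e + f})"
    then obtain e t where "e \<in> E" "q = e + (0, t)" "0 \<le> t"
      by auto
    then have "(fst q, snd e) \<in> E" "snd e \<le> snd q"
      by simp_all
    then show "q \<in> ?B"
      by blast
  qed
  moreover have "closed (\<Union>e\<in>E. \<Union>f\<in>{0} \<times> {..0}. {e + f})"
    using assms by (intro compact_closed_sums closed_Times) auto
  moreover have "closed (\<Union>e\<in>E. \<Union>f\<in>{0} \<times> {0..}. {e + f})"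
    using assms by (intro compact_closed_sums closed_Times) auto
  ultimately show "closed ?A" "closed ?B"
    by simp_all
qed

text \<open>The open band of points below \<open>E\<close> and above \<open>F\<close> is relatively clopen in the complement of \<open>C\<close>:
  a boundary point of the band off \<open>C\<close> would lie between two points of one column section.\<close>

lemma inside_if_between:
  fixes C E F :: "(real \<times> real) set"
  assumes "closed C" "compact E" "compact F" "E \<union> F \<subseteq> C"
    and ivl: "\<And>x. is_interval (Pair x -` E)" "\<And>x. is_interval (Pair x -` F)"
    and fst_E: "fst ` E = {0..m}" and fst_F: "fst ` F = {0..m}"
    and ends: "is_interval (Pair 0 -` C)" "is_interval (Pair m -` C)"
    and "(x, w) \<notin> C" "w \<le> y" "(x, y) \<in> E" "z \<le> w" "(x, z) \<in> F"
  shows "(x, w) \<in> inside C"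
proof -
  \<comment> \<open>\<open>A\<close> is the closed band. \<open>B\<close> replaces each condition by
    the negation of the opposite one, which makes it open; the two agree off
    \<open>C\<close>.\<close>
  define A where "A = {q. \<exists>y\<ge>snd q. (fst q, y) \<in> E} \<inter> {q. \<exists>y\<le>snd q. (fst q, y) \<in> F}"
  define B where "B = - {q. \<exists>y\<le>snd q. (fst q, y) \<in> E} \<inter> - {q. \<exists>y\<ge>snd q. (fst q, y) \<in> F}
    \<inter> {0<..<m} \<times> UNIV"
  have "closed A" "open B"
    unfolding A_def B_def using assms
    by (auto intro!: closed_Int open_Int open_Times closed_vertical_shadow
        simp: open_Compl[OF closed_vertical_shadow(1)] open_Compl[OF closed_vertical_shadow(2)])
  have between: "(a, v) \<in> S" if "is_interval (Pair a -` S)" "(a, u) \<in> S" "(a, t) \<in> S" "u \<le> v" "v \<le> t"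
    for a u v t and S :: "(real \<times> real) set"
    using that unfolding is_interval_1 by blast
  have AB: "q \<in> A \<longleftrightarrow> q \<in> B" if "q \<notin> C" for q
  proof
    assume "q \<in> A"
    then obtain y z where yz: "snd q \<le> y" "(fst q, y) \<in> E" "z \<le> snd q" "(fst q, z) \<in> F"
      by (auto simp: A_def)
    then have "fst q \<in> fst ` E"
      by (metis fst_conv image_eqI)
    then have "fst q \<in> {0..m}"
      by (simp add: fst_E)
    \<comment> \<open>An interval section would contain \<open>snd q\<close> along with
      \<open>z\<close> and \<open>y\<close>, against \<open>q \<notin> C\<close>; hence
      \<open>q\<close> lies in neither end column.\<close>
    moreover have "\<not> is_interval (Pair (fst q) -` C)"
      using that yz between[of "fst q" C z y "snd q"] \<open>E \<union> F \<subseteq> C\<close> by auto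
    then have "fst q \<noteq> 0" "fst q \<noteq> m"
      using ends by metis+
    ultimately have "fst q \<in> {0<..<m}"
      by auto
    moreover have "q \<notin> E" "q \<notin> F"
      using that \<open>E \<union> F \<subseteq> C\<close> by auto
    then have "\<not> (\<exists>t\<le>snd q. (fst q, t) \<in> E)" "\<not> (\<exists>t\<ge>snd q. (fst q, t) \<in> F)"
      using \<open>q \<notin> E\<close> \<open>q \<notin> F\<close> ivl yz between[of "fst q" E _ y "snd q"]
        between[of "fst q" F z _ "snd q"] by auto
    ultimately show "q \<in> B"
      by (cases q) (auto simp: B_def)
  next
    assume q: "q \<in> B"
    then have "fst q \<in> fst ` E" "fst q \<in> fst ` F"
      using fst_E fst_F by (auto simp: B_def)
    then obtain y z where "(fst q, y) \<in> E" "(fst q, z) \<in> F"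
      by auto
    then show "q \<in> A"
      using q by (auto simp: A_def B_def) (meson linear)+
  qed
  define K where "K = connected_component_set (- C) (x, w)"
  have "(x, w) \<in> A"
    using assms by (auto simp: A_def)
  have K: "connected K" "K \<subseteq> - C" "(x, w) \<in> K"
    using \<open>(x, w) \<notin> C\<close> connected_component_subset by (auto simp: K_def)
  \<comment> \<open>The open sets \<open>B\<close> and \<open>- A\<close> cover \<open>K\<close> and
    are disjoint on it, because \<open>K\<close> misses \<open>C\<close>.\<close>
  have "B \<inter> K = {} \<or> - A \<inter> K = {}"
    using K AB \<open>closed A\<close> \<open>open B\<close> by (intro connectedD) auto
  then have "K \<subseteq> A"
    using K AB \<open>(x, w) \<in> A\<close> \<open>(x, w) \<notin> C\<close> by blast
  have "bounded (snd ` E)" "bounded (snd ` F)"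
    using assms compact_imp_bounded bounded_snd by blast+
  then obtain M N where M: "\<And>q. q \<in> E \<Longrightarrow> \<bar>snd q\<bar> \<le> M" and N: "\<And>q. q \<in> F \<Longrightarrow> \<bar>snd q\<bar> \<le> N"
    unfolding bounded_iff by auto
  have "A \<subseteq> {0..m} \<times> {-N..M}"
  proof
    fix q assume "q \<in> A"
    then obtain y z where yz: "snd q \<le> y" "(fst q, y) \<in> E" "z \<le> snd q" "(fst q, z) \<in> F"
      by (auto simp: A_def)
    then have "fst q \<in> fst ` E" "\<bar>y\<bar> \<le> M" "\<bar>z\<bar> \<le> N"
      using M N by (metis fst_conv image_eqI) (metis M N snd_conv yz)+
    then show "q \<in> {0..m} \<times> {-N..M}"
      using yz fst_E by (cases q) auto
  qed
  then have "bounded K"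
    using \<open>K \<subseteq> A\<close>
    by (intro bounded_subset[OF bounded_Times[of "{0..m}" "{-N..M}"]]) (auto simp: compact_imp_bounded)
  then show ?thesis
    using \<open>(x, w) \<notin> C\<close> by (auto simp: inside_def K_def)
qed

text \<open>Vertical rays from the two given points meet \<open>C\<close> below and above
  \<open>w\<close>. Off the end columns both hits lie on \<open>E\<close> or \<open>F\<close>: if on
  the same curve, its interval section contains \<open>w\<close>; if on different curves,
  \<open>w\<close> lies between them. Neither curve is assumed to be the upper one, so both orders
  are treated.\<close>

lemma column_convex_filled_band:
  fixes C E F :: "(real \<times> real) set"
  assumes "closed C" "compact E" "compact F" "E \<union> F \<subseteq> C"
    and ivl: "\<And>x. is_interval (Pair x -` E)" "\<And>x. is_interval (Pair x -` F)"
    and fst: "fst ` E = {0..m}" "fst ` F = {0..m}"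
    and ends: "is_interval (Pair 0 -` C)" "is_interval (Pair m -` C)"
    and C: "C \<subseteq> E \<union> F \<union> {0, m} \<times> UNIV"
    and y: "(x, y) \<in> C \<union> inside C" and z: "(x, z) \<in> C \<union> inside C" and "y \<le> w" "w \<le> z"
  shows "(x, w) \<in> C \<union> inside C"
proof (cases "(x, w) \<in> C")
  case False
  obtain u where u: "u \<le> y" "(x, u) \<in> C"
    using section_extends_above_below[OF y] by blast
  obtain v where v: "z \<le> v" "(x, v) \<in> C"
    using section_extends_above_below[OF z] by blast
  have between: "(x, w) \<in> S" if "is_interval (Pair x -` S)" "(x, u) \<in> S" "(x, v) \<in> S"
    for S :: "(real \<times> real) set"
    using that \<open>y \<le> w\<close> \<open>w \<le> z\<close> u(1) v(1) unfolding is_interval_1 by (meson order_trans vimageD vimageI)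
  have "x \<notin> {0, m}"
    using between[of C] ends u v False by auto
  then have "(x, u) \<in> E \<union> F" "(x, v) \<in> E \<union> F"
    using C u v by auto
  then consider "(x, u) \<in> E" "(x, v) \<in> F" | "(x, u) \<in> F" "(x, v) \<in> E"
    using between ivl False \<open>E \<union> F \<subseteq> C\<close> by blast
  then show ?thesis
  proof cases
    case 1
    then have "(x, w) \<in> inside C"
      using assms False u v by (intro inside_if_between[of C F E m x w v u]) auto
    then show ?thesis by simp
  next
    case 2
    then have "(x, w) \<in> inside C"
      using assms False u v by (intro inside_if_between[of C E F m x w v u]) auto
    then show ?thesis by simp
  qed
qed simp

lemma column_convex_lattice_region:
  fixes m a\<^sub>0 a\<^sub>1 b\<^sub>0 b\<^sub>1 :: int and \<eta>p \<eta>m :: "(int \<times> int) list"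
  defines "\<Gamma> \<equiv> lattice_region (boundary_curve m a\<^sub>0 a\<^sub>1 b\<^sub>0 b\<^sub>1 \<eta>p \<eta>m)"
  assumes "0 < m" "a\<^sub>0 \<le> a\<^sub>1" "b\<^sub>0 \<le> b\<^sub>1"
    and \<eta>p: "\<eta>p \<noteq> []" "x_monotone \<eta>p" "hd \<eta>p = (0, a\<^sub>1)" "last \<eta>p = (m, b\<^sub>1)"
    and \<eta>m: "\<eta>m \<noteq> []" "x_monotone \<eta>m" "hd \<eta>m = (0, a\<^sub>0)" "last \<eta>m = (m, b\<^sub>0)"
  shows "finite \<Gamma>" "fst ` \<Gamma> \<subseteq> {0..m}"
    "\<And>x y z w. (x, y) \<in> \<Gamma> \<Longrightarrow> (x, z) \<in> \<Gamma> \<Longrightarrow> y \<le> w \<Longrightarrow> w \<le> z \<Longrightarrow> (x, w) \<in> \<Gamma>"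
    "vertical_interval 0 a\<^sub>0 a\<^sub>1 \<subseteq> \<Gamma>"
proof -
  define S T where "S = closed_segment (plane_point (0, a\<^sub>0)) (plane_point (0, a\<^sub>1))"
    and "T = closed_segment (plane_point (m, b\<^sub>0)) (plane_point (m, b\<^sub>1))"
  define E F where "E = path_curve \<eta>p" and "F = path_curve \<eta>m"
  define C where "C = boundary_curve m a\<^sub>0 a\<^sub>1 b\<^sub>0 b\<^sub>1 \<eta>p \<eta>m"
  have C_eq: "C = S \<union> E \<union> F \<union> T"
    by (simp add: C_def boundary_curve_def S_def T_def E_def F_def)
  have S_eq: "S = {0} \<times> {real_of_int a\<^sub>0..a\<^sub>1}" and T_eq: "T = {real_of_int m} \<times> {real_of_int b\<^sub>0..b\<^sub>1}"
    using \<open>a\<^sub>0 \<le> a\<^sub>1\<close> \<open>b\<^sub>0 \<le> b\<^sub>1\<close>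
    by (simp_all add: S_def T_def plane_point_def closed_segment_same_fst closed_segment_eq_real_ivl)
  have E: "compact E" "\<And>x. is_interval (Pair x -` E)" "fst ` E = {0..real_of_int m}"
    and F: "compact F" "\<And>x. is_interval (Pair x -` F)" "fst ` F = {0..real_of_int m}"
    using \<eta>p \<eta>m path_curve_sections by (auto simp: E_def F_def compact_path_curve)
  have "compact C"
    unfolding C_eq S_def T_def using E F by (intro compact_Un) auto
  have hds: "(0, real_of_int a\<^sub>1) \<in> E" "(0, real_of_int a\<^sub>0) \<in> F"
     "(real_of_int m, real_of_int b\<^sub>1) \<in> E" "(real_of_int m, real_of_int b\<^sub>0) \<in> F"
    using plane_point_in_path_curve[OF hd_in_set[OF \<eta>p(1)]] plane_point_in_path_curve[OF last_in_set[OF \<eta>p(1)]]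
      plane_point_in_path_curve[OF hd_in_set[OF \<eta>m(1)]] plane_point_in_path_curve[OF last_in_set[OF \<eta>m(1)]]
      \<eta>p \<eta>m by (auto simp: E_def F_def plane_point_def)
  \<comment> \<open>Both paths may have vertical stretches in this column. The segment
    \<open>S\<close> links them, as it shares its top endpoint with \<eta>p and its bottom endpoint
    with \<eta>m.\<close>
  have "Pair 0 -` C = (Pair 0 -` E \<union> {real_of_int a\<^sub>0..a\<^sub>1}) \<union> Pair 0 -` F"
    using \<open>0 < m\<close> by (auto simp: C_eq S_eq T_eq)
  also have "is_interval \<dots>"
  proof (intro is_interval_Un is_interval_cc E F)
    have "real_of_int a\<^sub>1 \<in> Pair 0 -` E \<inter> {real_of_int a\<^sub>0..real_of_int a\<^sub>1}"
      using hds \<open>a\<^sub>0 \<le> a\<^sub>1\<close> by simp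
    then show "Pair 0 -` E \<inter> {real_of_int a\<^sub>0..real_of_int a\<^sub>1} \<noteq> {}"
      by blast
    have "real_of_int a\<^sub>0 \<in> (Pair 0 -` E \<union> {real_of_int a\<^sub>0..real_of_int a\<^sub>1}) \<inter> Pair 0 -` F"
      using hds \<open>a\<^sub>0 \<le> a\<^sub>1\<close> by simp
    then show "(Pair 0 -` E \<union> {real_of_int a\<^sub>0..real_of_int a\<^sub>1}) \<inter> Pair 0 -` F \<noteq> {}"
      by blast
  qed
  finally have end0: "is_interval (Pair 0 -` C)" .
  have "Pair (real_of_int m) -` C = (Pair (real_of_int m) -` E \<union> {real_of_int b\<^sub>0..b\<^sub>1}) \<union> Pair (real_of_int m) -` F"
    using \<open>0 < m\<close> by (auto simp: C_eq S_eq T_eq)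
  also have "is_interval \<dots>"
  proof (intro is_interval_Un is_interval_cc E F)
    have "real_of_int b\<^sub>1 \<in> Pair (real_of_int m) -` E \<inter> {real_of_int b\<^sub>0..real_of_int b\<^sub>1}"
      using hds \<open>b\<^sub>0 \<le> b\<^sub>1\<close> by simp
    then show "Pair (real_of_int m) -` E \<inter> {real_of_int b\<^sub>0..real_of_int b\<^sub>1} \<noteq> {}"
      by blast
    have "real_of_int b\<^sub>0 \<in> (Pair (real_of_int m) -` E \<union> {real_of_int b\<^sub>0..real_of_int b\<^sub>1}) \<inter> Pair (real_of_int m) -` F"
      using hds \<open>b\<^sub>0 \<le> b\<^sub>1\<close> by simp
    then show "(Pair (real_of_int m) -` E \<union> {real_of_int b\<^sub>0..real_of_int b\<^sub>1}) \<inter> Pair (real_of_int m) -` F \<noteq> {}"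
      by blast
  qed
  finally have endm: "is_interval (Pair (real_of_int m) -` C)" .
  have fst_C: "fst ` C = {0..real_of_int m}"
    using \<open>0 < m\<close> \<open>a\<^sub>0 \<le> a\<^sub>1\<close> \<open>b\<^sub>0 \<le> b\<^sub>1\<close> unfolding C_eq image_Un E(3) F(3) S_eq T_eq by auto
  have \<Gamma>: "(x, y) \<in> \<Gamma> \<longleftrightarrow> (real_of_int x, real_of_int y) \<in> C \<union> inside C" for x y
    by (simp add: \<Gamma>_def lattice_region_def C_def plane_point_def)
  show "(x, w) \<in> \<Gamma>" if "(x, y) \<in> \<Gamma>" "(x, z) \<in> \<Gamma>" "y \<le> w" "w \<le> z" for x y z w
    unfolding \<Gamma>
  proof (rule column_convex_filled_band[of C E F])
    show "closed C" "E \<union> F \<subseteq> C" "C \<subseteq> E \<union> F \<union> {0, real_of_int m} \<times> UNIV"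
      using \<open>compact C\<close> by (auto simp: compact_imp_closed C_eq S_eq T_eq)
    show "(real_of_int x, real_of_int y) \<in> C \<union> inside C" "(real_of_int x, real_of_int z) \<in> C \<union> inside C"
      using that by (simp_all only: \<Gamma>)
  qed (use that E F end0 endm in simp_all)
  show "fst ` \<Gamma> \<subseteq> {0..m}"
  proof safe
    fix x y assume "(x, y) \<in> \<Gamma>"
    then obtain u where "(real_of_int x, u) \<in> C"
      using section_extends_above_below[of x y C] unfolding \<Gamma> by metis
    then have "real_of_int x \<in> fst ` C"
      by force
    then show "fst (x, y) \<in> {0..m}"
      by (simp add: fst_C)
  qed
  show "vertical_interval 0 a\<^sub>0 a\<^sub>1 \<subseteq> \<Gamma>"
    by (auto simp: \<Gamma> vertical_interval_def C_eq S_eq)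
  have "bounded (snd ` C)"
    using \<open>compact C\<close> compact_imp_bounded bounded_snd by blast
  then obtain M where M: "\<And>q. q \<in> C \<Longrightarrow> \<bar>snd q\<bar> \<le> M"
    unfolding bounded_iff by auto
  have "\<Gamma> \<subseteq> {0..m} \<times> {\<lfloor>-M\<rfloor>..\<lceil>M\<rceil>}"
  proof safe
    fix x y assume xy: "(x, y) \<in> \<Gamma>"
    then show "x \<in> {0..m}"
      using \<open>fst ` \<Gamma> \<subseteq> {0..m}\<close> by force
    obtain u v where "u \<le> real_of_int y" "(real_of_int x, u) \<in> C" "real_of_int y \<le> v" "(real_of_int x, v) \<in> C"
      using xy section_extends_above_below[of x y C] unfolding \<Gamma> by metis
    then have "-M \<le> y" "y \<le> M"
      using M[of "(x, u)"] M[of "(x, v)"] by auto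
    then show "y \<in> {\<lfloor>-M\<rfloor>..\<lceil>M\<rceil>}"
      unfolding atLeastAtMost_iff floor_le_iff le_ceiling_iff by simp
  qed
  then show "finite \<Gamma>"
    by (rule finite_subset) simp
qed

section \<open>Exit probabilities as harmonic functions\<close>

definition neighbour_mean :: "(int \<times> int \<Rightarrow> real) \<Rightarrow> int \<times> int \<Rightarrow> real" where
  "neighbour_mean h v = (\<Sum>s\<in>unit_steps. h (v + s)) / 4"

lemma finite_unit_steps [simp]: "finite unit_steps"
  and card_unit_steps [simp]: "card unit_steps = 4"
  and unit_steps_nonempty [simp]: "unit_steps \<noteq> {}"
  by (simp_all add: unit_steps_def)

lemma neighbour_mean_diff_scale:
  "neighbour_mean (\<lambda>v. a * f v - b * g v) v = a * neighbour_mean f v - b * neighbour_mean g v"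
  by (simp add: neighbour_mean_def sum_subtractf sum_distrib_left diff_divide_distrib)

lemma neighbour_mean_diff:
  "neighbour_mean (\<lambda>v. f v - g v) v = neighbour_mean f v - neighbour_mean g v"
  using neighbour_mean_diff_scale[of 1 f 1 g v] by simp

text \<open>At a negative minimum all four neighbour values equal the minimum, and the neighbour
  above is again in \<open>F\<close> because boundary values are nonnegative. The minimizers would
  be closed under upward steps, which is impossible in a finite set.\<close>

lemma minimum_principle:
  assumes "finite F"
    and harm: "\<And>v. v \<in> F \<Longrightarrow> h v = neighbour_mean h v"
    and bdry: "\<And>v s. v \<in> F \<Longrightarrow> s \<in> unit_steps \<Longrightarrow> v + s \<notin> F \<Longrightarrow> 0 \<le> h (v + s)"
    and "v \<in> F"
  shows "0 \<le> h v"
proof (rule ccontr)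
  assume neg: "\<not> 0 \<le> h v"
  define \<mu> where "\<mu> = Min (h ` F)"
  have \<mu>_le: "\<mu> \<le> h u" if "u \<in> F" for u
    using that \<open>finite F\<close> by (simp add: \<mu>_def)
  have "\<mu> < 0"
    using \<mu>_le[OF \<open>v \<in> F\<close>] neg by linarith
  define Z where "Z = {u \<in> F. h u = \<mu>}"
  have "finite Z"
    using \<open>finite F\<close> by (simp add: Z_def)
  have "\<mu> \<in> h ` F"
    unfolding \<mu>_def using \<open>finite F\<close> \<open>v \<in> F\<close> by (intro Min_in) auto
  then have "Z \<noteq> {}"
    by (auto simp: Z_def)
  have up: "u + (0, 1) \<in> Z" if "u \<in> Z" for u
  proof -
    have u: "u \<in> F" "h u = \<mu>"
      using that by (auto simp: Z_def)
    have ge: "\<mu> \<le> h (u + s)" if "s \<in> unit_steps" for s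
      using bdry[OF u(1) that] \<mu>_le[of "u + s"] \<open>\<mu> < 0\<close> by (cases "u + s \<in> F") auto
    have "(\<Sum>s\<in>unit_steps. h (u + s) - \<mu>) = 0"
      using harm[OF u(1)] u(2) by (simp add: neighbour_mean_def sum_subtractf)
    then have "\<forall>s\<in>unit_steps. h (u + s) - \<mu> = 0"
      using ge by (subst (asm) sum_nonneg_eq_0_iff) auto
    then have "h (u + (0, 1)) = \<mu>"
      by (simp add: unit_steps_def)
    moreover have "u + (0, 1) \<in> F"
      using bdry[OF u(1), of "(0, 1)"] \<open>\<mu> < 0\<close> calculation by (force simp: unit_steps_def)
    ultimately show ?thesis
      by (simp add: Z_def)
  qed
  obtain u where u: "u \<in> Z" "snd u = Max (snd ` Z)"
    using Max_in[of "snd ` Z"] \<open>finite Z\<close> \<open>Z \<noteq> {}\<close> by fastforce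
  have "snd (u + (0, 1)) \<le> Max (snd ` Z)"
    using up[OF u(1)] \<open>finite Z\<close> by (intro Max_ge finite_imageI imageI)
  then show False
    using u(2) by simp
qed

text \<open>The probability that the simple walk from \<open>v\<close> is in \<open>F\<close> at
  times \<open>0, ..., n - 1\<close> and at \<open>e\<close> at time \<open>n\<close>, given by its
  first-step recursion so that the potential theory needs no probability space.\<close>

primrec hit_weight :: "(int \<times> int) set \<Rightarrow> int \<times> int \<Rightarrow> nat \<Rightarrow> int \<times> int \<Rightarrow> real" where
  "hit_weight F e 0 v = of_bool (v = e)"
| "hit_weight F e (Suc n) v = (if v \<in> F then neighbour_mean (hit_weight F e n) v else 0)"

definition exit_weight :: "(int \<times> int) set \<Rightarrow> int \<times> int \<Rightarrow> int \<times> int \<Rightarrow> real" where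
  "exit_weight F e v = (\<Sum>n. hit_weight F e n v)"

lemma hit_weight_nonneg: "0 \<le> hit_weight F e n v"
  by (induction n arbitrary: v) (auto simp: neighbour_mean_def intro: sum_nonneg)

text \<open>As \<open>e \<notin> F\<close>, the term of index 0 and the average over the neighbours
  are never both nonzero, so the first-step recursion preserves the bound.\<close>

lemma sum_hit_weight_le_1:
  assumes "e \<notin> F"
  shows "(\<Sum>n<N. hit_weight F e n v) \<le> 1"
proof (induction N arbitrary: v)
  case (Suc N)
  have "(\<Sum>n<Suc N. hit_weight F e n v) = of_bool (v = e) + 
      (if v \<in> F then (\<Sum>s\<in>unit_steps. \<Sum>n<N. hit_weight F e n (v + s)) / 4 else 0)"
    by (simp only: sum.lessThan_Suc_shift hit_weight.simps neighbour_mean_def o_def)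
       (simp add: sum_divide_distrib[symmetric] sum.swap[of _ unit_steps])
  moreover have "(\<Sum>s\<in>unit_steps. \<Sum>n<N. hit_weight F e n (v + s)) \<le> (\<Sum>s\<in>unit_steps. 1)"
    by (intro sum_mono Suc)
  ultimately show ?case
    using assms by auto
qed simp

lemma summable_hit_weight: "e \<notin> F \<Longrightarrow> summable (\<lambda>n. hit_weight F e n v)"
  using hit_weight_nonneg sum_hit_weight_le_1 by (rule summableI_nonneg_bounded)

lemma exit_weight_nonneg: "e \<notin> F \<Longrightarrow> 0 \<le> exit_weight F e v"
  unfolding exit_weight_def by (intro suminf_nonneg summable_hit_weight hit_weight_nonneg)

lemma exit_weight_outside:
  assumes "e \<notin> F" "v \<notin> F"
  shows "exit_weight F e v = of_bool (v = e)"
proof -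
  have "hit_weight F e n v = 0" if "n \<noteq> 0" for n
    using that assms by (cases n) auto
  then have "exit_weight F e v = (\<Sum>n\<in>{0}. hit_weight F e n v)"
    unfolding exit_weight_def by (intro suminf_finite) auto
  then show ?thesis
    by simp
qed

lemma exit_weight_harmonic:
  assumes "e \<notin> F" "v \<in> F"
  shows "exit_weight F e v = neighbour_mean (exit_weight F e) v"
proof -
  have "exit_weight F e v = (\<Sum>n. hit_weight F e (Suc n) v)"
    using suminf_split_head[OF summable_hit_weight[OF assms(1), of v]] assms
    by (auto simp: exit_weight_def)
  also have "\<dots> = (\<Sum>n. \<Sum>s\<in>unit_steps. hit_weight F e n (v + s) / 4)"
    using assms by (simp add: neighbour_mean_def sum_divide_distrib)
  also have "\<dots> = (\<Sum>s\<in>unit_steps. \<Sum>n. hit_weight F e n (v + s) / 4)"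
    by (intro suminf_sum summable_divide summable_hit_weight assms)
  also have "\<dots> = neighbour_mean (exit_weight F e) v"
    by (simp add: neighbour_mean_def sum_divide_distrib exit_weight_def suminf_divide
        summable_hit_weight assms)
  finally show ?thesis .
qed

lemma exit_weight_mono:
  assumes "F \<subseteq> D" "e \<notin> D"
  shows "exit_weight F e v \<le> exit_weight D e v"
proof -
  have "hit_weight F e n v \<le> hit_weight D e n v" for n
  proof (induction n arbitrary: v)
    case (Suc n)
    have "neighbour_mean (hit_weight F e n) v \<le> neighbour_mean (hit_weight D e n) v"
      unfolding neighbour_mean_def by (intro divide_right_mono sum_mono Suc) simp
    then show ?case
      using \<open>F \<subseteq> D\<close> hit_weight_nonneg[of D e "Suc n" v] by auto
  qed simp
  then show ?thesis
    unfolding exit_weight_def using assms by (intro suminf_le summable_hit_weight) auto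
qed

lemma exit_weight_translate:
  "exit_weight ((+) w ` F) (w + e) (w + v) = exit_weight F e v"
proof -
  have "hit_weight ((+) w ` F) (w + e) n (w + v) = hit_weight F e n v" for n
  proof (induction n arbitrary: v)
    case (Suc n)
    have "neighbour_mean (hit_weight ((+) w ` F) (w + e) n) (w + v) = neighbour_mean (hit_weight F e n) v"
      unfolding neighbour_mean_def add.assoc Suc ..
    moreover have "w + v \<in> (+) w ` F \<longleftrightarrow> v \<in> F"
      by auto
    ultimately show ?case
      by (simp only: hit_weight.simps)
  qed simp
  then show ?thesis
    by (simp add: exit_weight_def)
qed

section \<open>Comparing exit ratios by walks of constant sign\<close>

definition walk :: "int \<times> int \<Rightarrow> int \<times> int \<Rightarrow> (int \<times> int) list \<Rightarrow> bool" where
  "walk u v ps \<longleftrightarrow> ps \<noteq> [] \<and> hd ps = u \<and> last ps = v \<and> successively (\<lambda>p q. q - p \<in> unit_steps) ps"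

text \<open>Let \<open>R\<close> collect the vertices reached from \<open>v\<close> by walks on
  which \<open>h < 0\<close>. If \<open>e\<close> were missing, \<open>R\<close> would be a subset
  of \<open>F\<close> with \<open>h\<close> nonnegative at all neighbours outside it, and the
  minimum principle on \<open>R\<close> would contradict \<open>h v < 0\<close>.\<close>

lemma negative_walk_to_boundary:
  assumes "finite F"
    and harm: "\<And>v. v \<in> F \<Longrightarrow> h v = neighbour_mean h v"
    and bdry: "\<And>v. v \<notin> F \<Longrightarrow> h v < 0 \<Longrightarrow> v = e"
    and "h v < 0"
  obtains ps where "walk v e ps" "\<And>p. p \<in> set ps \<Longrightarrow> h p < 0"
proof -
  define R where "R = {u. \<exists>ps. walk v u ps \<and> (\<forall>p\<in>set ps. h p < 0)}"
  have vR: "v \<in> R"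
    using \<open>h v < 0\<close> by (auto simp: R_def walk_def intro!: exI[of _ "[v]"])
  have neg: "h u < 0" if "u \<in> R" for u
    using that by (auto simp: R_def walk_def)
  have step: "u + s \<in> R" if "u \<in> R" "s \<in> unit_steps" "h (u + s) < 0" for u s
  proof -
    obtain ps where "walk v u ps" "\<forall>p\<in>set ps. h p < 0"
      using \<open>u \<in> R\<close> by (auto simp: R_def)
    then have "walk v (u + s) (ps @ [u + s])" "\<forall>p\<in>set (ps @ [u + s]). h p < 0"
      using that by (auto simp: walk_def successively_append_iff)
    then show ?thesis
      unfolding R_def by blast
  qed
  have "e \<in> R"
  proof (rule ccontr)
    assume "e \<notin> R"
    then have "R \<subseteq> F"
      using neg bdry by blast
    have "0 \<le> h v"
    proof (rule minimum_principle[of R h v])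
      show "finite R"
        using \<open>R \<subseteq> F\<close> \<open>finite F\<close> by (rule finite_subset)
      show "0 \<le> h (u + s)" if "u \<in> R" "s \<in> unit_steps" "u + s \<notin> R" for u s
        using step[OF that(1,2)] that(3) by linarith
    qed (use \<open>R \<subseteq> F\<close> harm vR in auto)
    then show False
      using \<open>h v < 0\<close> by simp
  qed
  then show ?thesis
    using that by (auto simp: R_def)
qed

lemma exit_weight_ratio_le_if_walks_meet:
  assumes "finite F" "c \<notin> F" "d \<notin> F" "c \<noteq> d"
    and meet: "\<And>ps qs. walk p d ps \<Longrightarrow> walk q c qs \<Longrightarrow> set ps \<subseteq> F \<union> {c, d} \<Longrightarrow>
      set qs \<subseteq> F \<union> {c, d} \<Longrightarrow> set ps \<inter> set qs \<noteq> {}"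
  shows "exit_weight F c q * exit_weight F d p \<le> exit_weight F d q * exit_weight F c p"
proof (rule ccontr)
  let ?r = "exit_weight F c" and ?s = "exit_weight F d"
  assume contr: "\<not> ?thesis"
  \<comment> \<open>With this choice \<open>h p\<close> is the right side minus the left side of the
    claim, and \<open>h q\<close> is its negative. Nonnegativity of \<open>A\<close> and
    \<open>B\<close> confines negative values outside \<open>F\<close> to \<open>d\<close> and
    positive ones to \<open>c\<close>.\<close>
  define A B where "A = ?s p + ?s q" and "B = ?r p + ?r q"
  define h where "h = (\<lambda>v. A * ?r v - B * ?s v)"
  have AB: "0 \<le> A" "0 \<le> B"
    using assms by (auto simp: A_def B_def exit_weight_nonneg)
  have "h p = ?s q * ?r p - ?r q * ?s p" "h q = ?r q * ?s p - ?s q * ?r p"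
    unfolding h_def A_def B_def by algebra+
  then have h_p: "h p < 0" and h_q: "h q > 0"
    using contr by linarith+
  have out: "h v = A * of_bool (v = c) - B * of_bool (v = d)" if "v \<notin> F" for v
    using that assms by (simp add: h_def exit_weight_outside)
  have bdry: "v = d" if "v \<notin> F" "h v < 0" for v
    using out[OF that(1)] that(2) AB by (cases "v = c"; cases "v = d") auto
  have bdry': "v = c" if "v \<notin> F" "- h v < 0" for v
    using out[OF that(1)] that(2) AB by (cases "v = c"; cases "v = d") auto
  have harm: "h v = neighbour_mean h v" if "v \<in> F" for v
    using that assms by (simp add: h_def neighbour_mean_diff_scale exit_weight_harmonic[symmetric])
  obtain ps where ps: "walk p d ps" "\<And>v. v \<in> set ps \<Longrightarrow> h v < 0"
    using negative_walk_to_boundary[where h = h, OF \<open>finite F\<close> harm bdry h_p] by blast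
  have harm': "- h v = neighbour_mean (\<lambda>v. - h v) v" if "v \<in> F" for v
    using harm[OF that] by (simp add: neighbour_mean_def sum_negf)
  obtain qs where qs: "walk q c qs" "\<And>v. v \<in> set qs \<Longrightarrow> - h v < 0"
    using negative_walk_to_boundary[where h = "\<lambda>v. - h v", OF \<open>finite F\<close> harm' bdry', of q] h_q
    by (metis neg_less_0_iff_less)
  have "set ps \<subseteq> F \<union> {c, d}" "set qs \<subseteq> F \<union> {c, d}"
    using ps(2) qs(2) bdry bdry' by blast+
  then obtain v where "v \<in> set ps" "v \<in> set qs"
    using meet[OF ps(1) qs(1)] by blast
  then show False
    using ps(2)[of v] qs(2)[of v] by linarith
qed

text \<open>A combination of the weights for \<open>D\<close> that vanishes at \<open>p\<close>,
  minus the same combination for \<open>F\<close>, is harmonic on \<open>F\<close>. It is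
  nonnegative on \<open>D - F\<close> by \<open>le\<close>, and zero outside \<open>D\<close>, where
  both have the same boundary values. The minimum principle at \<open>p\<close> is the
  claim.\<close>

lemma exit_weight_ratio_subdomain:
  assumes "finite D" "F \<subseteq> D" "c \<notin> D" "d \<notin> D" "c \<noteq> d" "p \<in> F"
    and le: "\<And>t. t \<in> D - F \<Longrightarrow>
      exit_weight D c t * exit_weight D d p \<le> exit_weight D d t * exit_weight D c p"
  shows "exit_weight F d p * exit_weight D c p \<le> exit_weight F c p * exit_weight D d p"
proof -
  let ?r = "exit_weight D c" and ?s = "exit_weight D d"
  have F: "finite F" "c \<notin> F" "d \<notin> F"
    using assms finite_subset by auto
  define g where "g = (\<lambda>v. ?r p * ?s v - ?s p * ?r v)"
  define g' where "g' = (\<lambda>v. ?r p * exit_weight F d v - ?s p * exit_weight F c v)"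
  have "0 \<le> g p - g' p"
  proof (rule minimum_principle[where h = "\<lambda>v. g v - g' v" and F = F])
    show "g v - g' v = neighbour_mean (\<lambda>v. g v - g' v) v" if "v \<in> F" for v
    proof -
      have "v \<in> D"
        using that assms by auto
      then have "g v = neighbour_mean g v"
        using assms by (simp add: g_def neighbour_mean_diff_scale exit_weight_harmonic[symmetric])
      moreover have "g' v = neighbour_mean g' v"
        using that F by (simp add: g'_def neighbour_mean_diff_scale exit_weight_harmonic[symmetric])
      ultimately show ?thesis
        by (simp add: neighbour_mean_diff)
    qed
    show "0 \<le> g (v + s) - g' (v + s)" if "v + s \<notin> F" for v s
    proof (cases "v + s \<in> D")
      case True
      then have "v + s \<noteq> c" "v + s \<noteq> d"
        using assms by auto
      then have "g' (v + s) = 0"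
        using that F by (simp add: g'_def exit_weight_outside)
      moreover have "0 \<le> g (v + s)"
        using le[of "v + s"] True that by (simp add: g_def mult.commute)
      ultimately show ?thesis
        by simp
    next
      case False
      then show ?thesis
        using that F assms by (simp add: g_def g'_def exit_weight_outside)
    qed
  qed (use F assms in auto)
  then show ?thesis
    by (simp add: g_def g'_def mult.commute)
qed

section \<open>Crossing walks in a strip\<close>

text \<open>The number of edges of the walk between columns \<open>fst v\<close> and \<open>fst v + 1\<close> at a height above \<open>snd v\<close>.\<close>

fun horizontal_crossings :: "(int \<times> int) list \<Rightarrow> int \<times> int \<Rightarrow> nat" where
  "horizontal_crossings (p # q # ps) v =
     of_bool (min (fst p) (fst q) = fst v \<and> fst p \<noteq> fst q \<and> snd v < snd p) + horizontal_crossings (q # ps) v"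
| "horizontal_crossings _ v = 0"

text \<open>For \<open>v\<close> off the walk, the walk enters and leaves the open vertical ray above \<open>v\<close> only through
  horizontal edges, so crossings on the two sides of the ray balance modulo its endpoints.\<close>

lemma horizontal_crossings_sides:
  assumes "successively (\<lambda>p q. q - p \<in> unit_steps) ps" "ps \<noteq> []" "v \<notin> set ps"
  shows "even (horizontal_crossings ps v + horizontal_crossings ps (v - (1, 0)) +
    of_bool (fst (hd ps) = fst v \<and> snd v < snd (hd ps)) +
    of_bool (fst (last ps) = fst v \<and> snd v < snd (last ps)))"
  using assms
proof (induction ps rule: induct_list012)
  case (3 p q ps)
  have IH: "even (horizontal_crossings (q # ps) v + horizontal_crossings (q # ps) (v - (1, 0)) +
    of_bool (fst q = fst v \<and> snd v < snd q) +
    of_bool (fst (last (q # ps)) = fst v \<and> snd v < snd (last (q # ps))))"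
    using 3 by simp
  define R L where "R \<longleftrightarrow> min (fst p) (fst q) = fst v \<and> fst p \<noteq> fst q \<and> snd v < snd p"
    and "L \<longleftrightarrow> min (fst p) (fst q) = fst v - 1 \<and> fst p \<noteq> fst q \<and> snd v < snd p"
  \<comment> \<open>A vertical edge cannot jump over \<open>v\<close>, which is neither of its ends.
    A horizontal edge above \<open>v\<close> with one end in this column contributes one crossing
    and one endpoint.\<close>
  have edge: "even (of_bool R + of_bool L + of_bool (fst p = fst v \<and> snd v < snd p) +
      of_bool (fst q = fst v \<and> snd v < snd q) :: nat)"
    using 3(3,5) unfolding R_def L_def
    by (cases p; cases q; cases v) (auto simp: unit_steps_def min_def algebra_simps)
  have Cons:
    "horizontal_crossings (p # q # ps) v = of_bool R + horizontal_crossings (q # ps) v"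
    "horizontal_crossings (p # q # ps) (v - (1, 0)) =
       of_bool L + horizontal_crossings (q # ps) (v - (1, 0))"
    "last (p # q # ps) = last (q # ps)" "hd (p # q # ps) = p"
    by (simp_all add: R_def L_def)
  have "even (r + r' + (l + l') + i + j)" if "even (r + l + i + t)" "even (r' + l' + t + j)"
    for r l i t r' l' j :: nat
    using that by presburger
  from this[OF edge IH] show ?case
    unfolding Cons .
qed auto

text \<open>Only an edge at height \<open>y + 1\<close> between columns \<open>x\<close> and
  \<open>x + 1\<close> could distinguish the two counts, and it would have \<open>(x, y + 1)\<close>
  as an end.\<close>

lemma horizontal_crossings_vertical_step:
  assumes "successively (\<lambda>p q. q - p \<in> unit_steps) ps" "(x, y + 1) \<notin> set ps"
  shows "horizontal_crossings ps (x, y + 1) = horizontal_crossings ps (x, y)"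
  using assms
proof (induction ps rule: induct_list012)
  case (3 p q ps)
  then show ?case
    by (cases p; cases q) (auto simp: unit_steps_def min_def)
qed auto

lemma horizontal_crossings_eq_0_above:
  assumes "\<And>p. p \<in> set ps \<Longrightarrow> fst p = fst v \<Longrightarrow> snd p \<le> snd v"
    and "successively (\<lambda>p q. q - p \<in> unit_steps) ps"
  shows "horizontal_crossings ps v = 0"
  using assms
proof (induction ps rule: induct_list012)
  case (3 p q ps)
  have "q - p \<in> unit_steps" "horizontal_crossings (q # ps) v = 0"
    using 3 by simp_all
  then show ?case
    using 3(3)[of p] 3(3)[of q] by (auto simp: unit_steps_def min_def prod_eq_iff)
qed auto

lemma horizontal_crossings_eq_0_right:
  assumes "\<And>p. p \<in> set ps \<Longrightarrow> fst p \<le> fst v"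
  shows "horizontal_crossings ps v = 0"
  using assms
proof (induction ps rule: induct_list012)
  case (3 p q ps)
  have "fst p \<le> fst v" "fst q \<le> fst v" "horizontal_crossings (q # ps) v = 0"
    using 3 by auto
  then show ?case
    by auto
qed auto

lemma unit_step_cases:
  assumes "q - p \<in> unit_steps"
  obtains "q = p + (1, 0)" | "p = q + (1, 0)" | "q = p + (0, 1)" | "p = q + (0, 1)"
proof -
  have "q = p + (1, 0) \<or> p = q + (1, 0) \<or> q = p + (0, 1) \<or> p = q + (0, 1)"
    using assms unfolding unit_steps_def by (simp add: prod_eq_iff) linarith
  then show thesis
    using that by blast
qed

text \<open>A discrete Jordan argument: the parity of crossings above a vertex tells on which side
  of \<open>ps\<close> it lies, and it is constant along a walk avoiding \<open>ps\<close>. But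
  \<open>t\<close> has no part of \<open>ps\<close> above it, while \<open>(m, k)\<close> lies below
  the end \<open>(m, l)\<close> of \<open>ps\<close>.\<close>

lemma walks_meet:
  assumes ps: "walk s (m, l) ps" and qs: "walk t (m, k) qs" and "k < l" "fst s < m"
    and strip: "fst ` (set ps \<union> set qs) \<subseteq> {fst s..m}"
    and above: "\<And>p. p \<in> set ps \<Longrightarrow> fst p = fst t \<Longrightarrow> snd p \<le> snd t"
  shows "set ps \<inter> set qs \<noteq> {}"
proof
  assume disj: "set ps \<inter> set qs = {}"
  \<comment> \<open>The extra summand counts a fictitious edge from \<open>(m, l)\<close> to
    \<open>(m + 1, l)\<close>, prolonging \<open>ps\<close> across the right side of the strip. It
    absorbs the endpoint term of \<open>(m, l)\<close> in \<open>horizontal_crossings_sides\<close>;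
    the term of \<open>s\<close> vanishes in every column to the right of \<open>s\<close>.\<close>
  define par where "par v = odd (horizontal_crossings ps v + of_bool (fst v = m \<and> snd v < l))" for v
  have ps': "successively (\<lambda>p q. q - p \<in> unit_steps) ps" "ps \<noteq> []" "hd ps = s" "last ps = (m, l)"
    using ps by (auto simp: walk_def)
  have right: "par (v + (1, 0)) = par v"
    if "v + (1, 0) \<notin> set ps" "fst s \<le> fst v" "fst v < m" for v
    using horizontal_crossings_sides[OF ps'(1,2) that(1)] that(2,3) ps'(3,4)
    by (auto simp: par_def algebra_simps)
  have up: "par (v + (0, 1)) = par v" if "v + (0, 1) \<notin> set ps" for v
    using horizontal_crossings_vertical_step[OF ps'(1), of "fst v" "snd v"] that ps'(2,4) last_in_set[of ps]
    by (cases v) (auto simp: par_def less_le)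
  have step: "par q = par p" if "q - p \<in> unit_steps" "p \<in> set qs" "q \<in> set qs" for p q
  proof -
    have in_strip: "fst s \<le> fst p" "fst p \<le> m" "fst s \<le> fst q" "fst q \<le> m"
      using strip that by auto
    have off: "p \<notin> set ps" "q \<notin> set ps"
      using disj that by auto
    show ?thesis
      using that(1)
      by (rule unit_step_cases) (use right[of p] right[of q] up[of p] up[of q] off in_strip in auto)
  qed
  have "par (last qs') = par (hd qs')"
    if "successively (\<lambda>p q. q - p \<in> unit_steps) qs'" "qs' \<noteq> []" "set qs' \<subseteq> set qs" for qs'
    using that
  proof (induction qs' rule: induct_list012)
    case (3 p q ps)
    then show ?case
      using step[of q p] by simp
  qed auto
  from this[of qs] have "par (m, k) = par t"
    using qs by (auto simp: walk_def)
  moreover have "horizontal_crossings ps t = 0"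
    using above ps'(1) by (rule horizontal_crossings_eq_0_above)
  then have "\<not> par t"
    using above[of "(m, l)"] ps' last_in_set[of ps] by (auto simp: par_def)
  moreover have "par (m, k)"
  proof -
    have "horizontal_crossings ps (m, k) = 0"
      using strip by (intro horizontal_crossings_eq_0_right) auto
    then show ?thesis
      using \<open>k < l\<close> by (simp add: par_def)
  qed
  ultimately show False
    by simp
qed

lemma walk_Cons: "q - p \<in> unit_steps \<Longrightarrow> walk q e ps \<Longrightarrow> walk p e (p # ps)"
  by (cases ps) (auto simp: walk_def)

lemma walk_reflect:
  assumes "walk u v ps"
  shows "walk (apsnd uminus u) (apsnd uminus v) (map (apsnd uminus) ps)"
proof -
  have "apsnd uminus q - apsnd uminus p \<in> unit_steps \<longleftrightarrow> q - p \<in> unit_steps" for p q :: "int \<times> int"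
    by (cases p; cases q) (auto simp: unit_steps_def)
  then show ?thesis
    using assms by (auto simp: walk_def hd_map last_map successively_map)
qed

text \<open>Reflection in the horizontal axis turns this into \<open>walks_meet\<close> with the two
  walks interchanged.\<close>

lemma walks_meet_below:
  assumes ps: "walk s (m, l) ps" and qs: "walk t (m, k) qs" and "k < l" "fst t < m"
    and strip: "fst ` (set ps \<union> set qs) \<subseteq> {fst t..m}"
    and below: "\<And>q. q \<in> set qs \<Longrightarrow> fst q = fst s \<Longrightarrow> snd s \<le> snd q"
  shows "set ps \<inter> set qs \<noteq> {}"
proof -
  have "set (map (apsnd uminus) qs) \<inter> set (map (apsnd uminus) ps) \<noteq> {}"
  proof (rule walks_meet)
    show "walk (apsnd uminus t) (m, - k) (map (apsnd uminus) qs)"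
      "walk (apsnd uminus s) (m, - l) (map (apsnd uminus) ps)"
      using walk_reflect[OF qs] walk_reflect[OF ps] by simp_all
  qed (use assms in \<open>auto simp: image_iff\<close>)
  moreover have "inj (apsnd uminus :: int \<times> int \<Rightarrow> _)"
    by (auto simp: inj_def)
  ultimately show ?thesis
    by (auto simp: inj_eq)
qed

section \<open>Log-concavity of exit weights\<close>

lemma ratio_chain:
  fixes u w u' w' ra sa rb sb :: real
  assumes "0 \<le> u" "u \<le> sa" "0 \<le> w'" "w' \<le> rb" "0 \<le> ra" "0 \<le> w" "0 \<le> sb" "0 \<le> u'"
    and "u * ra \<le> w * sa" "rb * sa \<le> sb * ra" "w' * sb \<le> u' * rb"
  shows "u * w' \<le> w * u'"
proof (cases "u = 0 \<or> w' = 0")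
  case True
  then show ?thesis
    using assms by auto
next
  case False
  \<comment> \<open>The bounds \<open>u \<le> sa\<close> and \<open>w' \<le> rb\<close> make the
    middle terms positive, so the common factor in the chain
    \<open>u / w \<le> sa / ra \<le> sb / rb \<le> u' / w'\<close> can be cancelled.\<close>
  then have "0 < rb * sa"
    using assms by (intro mult_pos_pos) auto
  then have pos: "0 < sb * ra"
    using assms by linarith
  have "(u * w') * (sb * ra) = (u * ra) * (w' * sb)"
    by (simp add: algebra_simps)
  also have "\<dots> \<le> (w * sa) * (u' * rb)"
    using assms by (intro mult_mono[OF assms(9,11)]) auto
  also have "\<dots> = (w * u') * (rb * sa)"
    by (simp add: algebra_simps)
  also have "\<dots> \<le> (w * u') * (sb * ra)"
    using assms by (intro mult_left_mono) auto
  finally show ?thesis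
    using pos by (simp only: mult_le_cancel_right_pos)
qed

theorem exit_weight_log_concave:
  fixes F :: "(int \<times> int) set" and m k :: int
  assumes "finite F" and strip: "fst ` F \<subseteq> {0..<m}" and "(0, 0) \<in> F"
    and convex: "\<And>x y z w. (x, y) \<in> F \<Longrightarrow> (x, z) \<in> F \<Longrightarrow> y \<le> w \<Longrightarrow> w \<le> z \<Longrightarrow> (x, w) \<in> F"
  shows "exit_weight F (m, k + 1) (0, 0) * exit_weight F (m, k - 1) (0, 0)
    \<le> (exit_weight F (m, k) (0, 0))\<^sup>2"
proof -
  define F' where "F' = (+) (0, 1) ` F"
  define D where "D = F \<union> F'"
  define c d where "c = (m, k)" and "d = (m, k + 1)"
  define a b :: "int \<times> int" where "a = (0, 0)" and "b = (0, 1)"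
  let ?r = "exit_weight D c" and ?s = "exit_weight D d"
  have F'_iff: "(x, y) \<in> F' \<longleftrightarrow> (x, y - 1) \<in> F" for x y
    by (force simp: F'_def image_iff)
  have mem: "a \<in> F" "b \<in> F'"
    using \<open>(0, 0) \<in> F\<close> by (auto simp: a_def b_def F'_iff)
  have D_strip: "fst ` D \<subseteq> {0..<m}"
    using strip by (auto simp: D_def F'_def)
  have "0 < m"
    using strip \<open>(0, 0) \<in> F\<close> by force
  have "finite D"
    using \<open>finite F\<close> by (simp add: D_def F'_def)
  have cd: "c \<notin> D" "d \<notin> D" "c \<noteq> d"
    using D_strip by (auto simp: c_def d_def)
  have walk_strip: "fst ` (set ps \<union> set qs) \<subseteq> {0..m}"
    if "set ps \<subseteq> D \<union> {c, d}" "set qs \<subseteq> D \<union> {c, d}" for ps qs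
  proof -
    have "fst ` (D \<union> {c, d}) \<subseteq> {0..m}"
      using D_strip \<open>0 < m\<close> by (auto simp: c_def d_def)
    then show ?thesis
      using that by blast
  qed
  \<comment> \<open>A vertex of \<open>D - F\<close> lies in \<open>F'\<close>, so the vertex below
    it lies in \<open>F\<close>. A vertex of \<open>D\<close> higher up would force \<open>t\<close>
    itself into \<open>F\<close> by column convexity.\<close>
  have top: "y \<le> snd t" if "t \<in> D - F" "(fst t, y) \<in> D" for t y
  proof -
    have "(fst t, snd t - 1) \<in> F" "(fst t, snd t) \<notin> F"
      using that(1) by (auto simp: D_def F'_iff[symmetric])
    then show ?thesis
      using that(2) convex[of "fst t" "snd t - 1" y "snd t"] convex[of "fst t" "snd t - 1" "y - 1" "snd t"]
      by (cases "y \<le> snd t") (auto simp: D_def F'_iff)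
  qed
  have bottom: "snd t \<le> y" if "t \<in> D - F'" "(fst t, y) \<in> D" for t y
  proof -
    have "(fst t, snd t) \<in> F" "(fst t, snd t - 1) \<notin> F"
      using that(1) by (auto simp: D_def F'_iff[symmetric])
    then show ?thesis
      using that(2) convex[of "fst t" y "snd t" "snd t - 1"] convex[of "fst t" "y - 1" "snd t" "snd t - 1"]
      by (cases "snd t \<le> y") (auto simp: D_def F'_iff)
  qed
  have ab: "?r b * ?s a \<le> ?s b * ?r a"
    using \<open>finite D\<close> cd
  proof (rule exit_weight_ratio_le_if_walks_meet)
    fix ps qs assume ps: "walk a d ps" "set ps \<subseteq> D \<union> {c, d}" and qs: "walk b c qs" "set qs \<subseteq> D \<union> {c, d}"
    \<comment> \<open>The extra column makes the start of \<open>qs\<close> the top of its column, as required for crossing.\<close>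
    have "set ((-1, 0) # ps) \<inter> set ((-1, 1) # qs) \<noteq> {}"
    proof (rule walks_meet)
      show "walk (-1, 0) (m, k + 1) ((-1, 0) # ps)" "walk (-1, 1) (m, k) ((-1, 1) # qs)"
        using ps(1) qs(1) by (auto intro!: walk_Cons simp: a_def b_def c_def d_def unit_steps_def)
    qed (use walk_strip[OF ps(2) qs(2)] \<open>0 < m\<close> in auto)
    then show "set ps \<inter> set qs \<noteq> {}"
      using walk_strip[OF ps(2) qs(2)] by force
  qed
  have "exit_weight F d a * ?r a \<le> exit_weight F c a * ?s a"
  proof (rule exit_weight_ratio_subdomain)
    fix t assume t: "t \<in> D - F"
    show "?r t * ?s a \<le> ?s t * ?r a"
      using \<open>finite D\<close> cd
    proof (rule exit_weight_ratio_le_if_walks_meet)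
      fix ps qs assume ps: "walk a d ps" "set ps \<subseteq> D \<union> {c, d}" and qs: "walk t c qs" "set qs \<subseteq> D \<union> {c, d}"
      \<comment> \<open>Since \<open>c\<close> and \<open>d\<close> are in column \<open>m\<close>,
        every vertex of \<open>ps\<close> in the column of \<open>t\<close> lies in
        \<open>D\<close>, and \<open>top\<close> applies.\<close>
      have "fst t < m"
        using t D_strip by force
      then have "snd p \<le> snd t" if "p \<in> set ps" "fst p = fst t" for p
        using that ps(2) top[OF t, of "snd p"] by (cases p) (auto simp: c_def d_def)
      then show "set ps \<inter> set qs \<noteq> {}"
        using ps(1) qs(1) walk_strip[OF ps(2) qs(2)] \<open>0 < m\<close>
        by (intro walks_meet[of a m "k + 1" ps t k qs]) (auto simp: a_def c_def d_def)
    qed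
  qed (use \<open>finite D\<close> cd mem in \<open>auto simp: D_def\<close>)
  \<comment> \<open>The mirror image of the preceding comparison: \<open>c\<close> and
    \<open>d\<close> change roles, and \<open>t\<close> is now the bottom of its column.\<close>
  moreover have "exit_weight F' c b * ?s b \<le> exit_weight F' d b * ?r b"
  proof (rule exit_weight_ratio_subdomain)
    fix t assume t: "t \<in> D - F'"
    have "?r b * ?s t \<le> ?s b * ?r t"
      using \<open>finite D\<close> cd
    proof (rule exit_weight_ratio_le_if_walks_meet)
      fix ps qs assume ps: "walk t d ps" "set ps \<subseteq> D \<union> {c, d}" and qs: "walk b c qs" "set qs \<subseteq> D \<union> {c, d}"
      have "fst t < m"
        using t D_strip by force
      then have "snd t \<le> snd q" if "q \<in> set qs" "fst q = fst t" for q
        using that qs(2) bottom[OF t, of "snd q"] by (cases q) (auto simp: c_def d_def)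
      then show "set ps \<inter> set qs \<noteq> {}"
        using ps(1) qs(1) walk_strip[OF ps(2) qs(2)] \<open>0 < m\<close>
        by (intro walks_meet_below[of t m "k + 1" ps b k qs]) (auto simp: b_def c_def d_def)
    qed
    then show "?s t * ?r b \<le> ?r t * ?s b"
      by (simp add: mult.commute)
  qed (use \<open>finite D\<close> cd mem in \<open>auto simp: D_def\<close>)
  moreover have nonneg: "0 \<le> exit_weight S e v" if "S \<subseteq> D" "e \<in> {c, d}" for S e v
    using that cd by (intro exit_weight_nonneg) auto
  ultimately have "exit_weight F d a * exit_weight F' c b \<le> exit_weight F c a * exit_weight F' d b"
  proof (intro ratio_chain[of "exit_weight F d a" "?s a" "exit_weight F' c b" "?r b" "?r a"
        "exit_weight F c a" "?s b" "exit_weight F' d b"] ab)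
    show "exit_weight F d a \<le> ?s a" "exit_weight F' c b \<le> ?r b"
      using cd by (auto intro!: exit_weight_mono simp: D_def)
  qed (auto simp: D_def)
  \<comment> \<open>The shift carries the exits \<open>(m, k - 1)\<close> and \<open>(m, k)\<close>
    to \<open>c\<close> and \<open>d\<close>, so both weights for \<open>F'\<close> become weights
    for \<open>F\<close>.\<close>
  moreover have "exit_weight F' c b = exit_weight F (m, k - 1) a"
    using exit_weight_translate[of "(0, 1)" F "(m, k - 1)" "(0, 0)"] by (simp add: F'_def c_def a_def b_def)
  moreover have "exit_weight F' d b = exit_weight F c a"
    using exit_weight_translate[of "(0, 1)" F "(m, k)" "(0, 0)"]
    by (simp add: F'_def c_def d_def a_def b_def add.commute)
  ultimately show ?thesis
    by (simp add: power2_eq_square a_def c_def d_def)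
qed

section \<open>The random walk\<close>

fun hits :: "(int \<times> int) set \<Rightarrow> int \<times> int \<Rightarrow> int \<times> int \<Rightarrow> (int \<times> int) list \<Rightarrow> bool" where
  "hits F e v [] \<longleftrightarrow> v = e"
| "hits F e v (s # ss) \<longleftrightarrow> v \<in> F \<and> hits F e (v + s) ss"

lemma hits_increments:
  "hits F e (x t) (map (\<lambda>i. x (Suc i) - x i) [t..<t + n]) \<longleftrightarrow>
     (\<forall>i\<in>{t..<t + n}. x i \<in> F) \<and> x (t + n) = e"
proof (induction n arbitrary: t)
  case (Suc n)
  have "[t..<t + Suc n] = t # [Suc t..<Suc t + n]" "{t..<t + Suc n} = insert t {Suc t..<Suc t + n}"
    by (auto simp: upt_rec)
  then show ?case
    using Suc[of "Suc t"] by simp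
qed simp

definition step_lists :: "nat \<Rightarrow> (int \<times> int) list set" where
  "step_lists n = {ss. set ss \<subseteq> unit_steps \<and> length ss = n}"

lemma finite_step_lists: "finite (step_lists n)"
  by (simp add: step_lists_def finite_lists_length_eq)

text \<open>Each of the \<open>4 ^ n\<close> step lists has weight \<open>(1 / 4) ^ n\<close>;
  splitting off the first step reproduces the recursion.\<close>

lemma hit_weight_eq_sum:
  "hit_weight F e n v = (\<Sum>ss\<in>step_lists n. of_bool (hits F e v ss) * (1 / 4) ^ n)"
proof (induction n arbitrary: v)
  case 0
  then show ?case
    by (simp add: step_lists_def conj_commute cong: conj_cong)
next
  case (Suc n)
  have lists: "step_lists (Suc n) = (\<lambda>(s, ss). s # ss) ` (unit_steps \<times> step_lists n)"
    by (force simp: step_lists_def length_Suc_conv)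
  have "(\<Sum>ss\<in>step_lists (Suc n). of_bool (hits F e v ss) * (1 / 4) ^ Suc n) =
      (\<Sum>s\<in>unit_steps. \<Sum>ss\<in>step_lists n.
        of_bool (v \<in> F) * (of_bool (hits F e (v + s) ss) * (1 / 4) ^ n / 4 :: real))"
  proof -
    have "(\<Sum>ss\<in>step_lists (Suc n). of_bool (hits F e v ss) * (1 / 4) ^ Suc n) =
        (\<Sum>(s, ss)\<in>unit_steps \<times> step_lists n. of_bool (hits F e v (s # ss)) * (1 / 4 :: real) ^ Suc n)"
      unfolding lists by (subst sum.reindex) (auto simp: inj_on_def intro!: sum.cong)
    also have "\<dots> = (\<Sum>(s, ss)\<in>unit_steps \<times> step_lists n.
        of_bool (v \<in> F) * (of_bool (hits F e (v + s) ss) * (1 / 4) ^ n / 4))"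
      by (intro sum.cong) auto
    finally show ?thesis
      by (simp only: sum.cartesian_product)
  qed
  also have "\<dots> = hit_weight F e (Suc n) v"
    by (auto simp: neighbour_mean_def Suc sum_divide_distrib)
  finally show ?case ..
qed

text \<open>A nonempty set of extended naturals attains its infimum, and the empty set has infimum
  infinity.\<close>

lemma hit_time_eq_enat_iff:
  "hit_time Y B \<omega> = enat t \<longleftrightarrow> Y t \<omega> \<in> Some ` B \<and> (\<forall>s<t. Y s \<omega> \<notin> Some ` B)"
proof -
  define A where "A = {enat t |t. Y t \<omega> \<in> Some ` B}"
  have A_iff: "enat s \<in> A \<longleftrightarrow> Y s \<omega> \<in> Some ` B" for s
    by (auto simp: A_def)
  have "Inf A = enat t \<longleftrightarrow> enat t \<in> A \<and> (\<forall>s<t. enat s \<notin> A)"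
  proof (intro iffI conjI allI impI)
    assume inf: "Inf A = enat t"
    then obtain x where "x \<in> A"
      by (auto simp: Inf_enat_def split: if_splits)
    then show "enat t \<in> A"
      using inf wellorder_InfI by metis
    show "enat s \<notin> A" if "s < t" for s
      using Inf_lower[of "enat s" A] inf that by auto
  next
    assume t: "enat t \<in> A \<and> (\<forall>s<t. enat s \<notin> A)"
    show "Inf A = enat t"
    proof (rule antisym)
      show "Inf A \<le> enat t"
        using t by (intro Inf_lower) simp
      show "enat t \<le> Inf A"
        using t by (intro Inf_greatest) (auto simp: A_def not_less[symmetric])
    qed
  qed
  then show ?thesis
    unfolding hit_time_def A_def[symmetric] A_iff .
qed

context
  fixes M :: "'a measure" and v :: "int \<times> int" and X :: "nat \<Rightarrow> 'a \<Rightarrow> int \<times> int"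
  assumes srw: "simple_random_walk M v X"
begin

interpretation prob_space M
  using srw by (simp add: simple_random_walk_def)

lemma measurable_walk [measurable]: "X t \<in> measurable M (count_space UNIV)"
  using srw by (simp add: simple_random_walk_def)

lemma indep_increments: "indep_vars (\<lambda>_. count_space UNIV) (\<lambda>t \<omega>. X (Suc t) \<omega> - X t \<omega>) UNIV"
  using srw by (simp add: simple_random_walk_def)

lemma distr_increment:
  "distr M (count_space UNIV) (\<lambda>\<omega>. X (Suc t) \<omega> - X t \<omega>) = measure_pmf (pmf_of_set unit_steps)"
  using srw by (simp add: simple_random_walk_def)

lemma measurable_increment [measurable]:
  "(\<lambda>\<omega>. X (Suc t) \<omega> - X t \<omega>) \<in> measurable M (count_space UNIV)"
  using indep_increments by (auto simp: indep_vars_def2)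

lemma prob_increments:
  assumes "ss \<in> step_lists n"
  shows "prob {\<omega> \<in> space M. map (\<lambda>i. X (Suc i) \<omega> - X i \<omega>) [0..<n] = ss} = (1 / 4) ^ n"
\<comment> \<open>The product formula for independent variables requires a nonempty index set, and
  an empty intersection would be the whole type instead of \<open>space M\<close>.\<close>
proof (cases "n = 0")
  case True
  then show ?thesis
    using assms by (simp add: step_lists_def prob_space)
next
  case False
  define Z where "Z = (\<lambda>t \<omega>. X (Suc t) \<omega> - X t \<omega>)"
  have indep: "indep_vars (\<lambda>_. count_space UNIV) Z UNIV"
    and distr: "distr M (count_space UNIV) (Z t) = measure_pmf (pmf_of_set unit_steps)"
    and Z: "Z t \<in> measurable M (count_space UNIV)" for t
    using indep_increments distr_increment measurable_increment by (simp_all add: Z_def)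
  have len: "length ss = n" "\<And>i. i < n \<Longrightarrow> ss ! i \<in> unit_steps"
    using assms by (auto simp: step_lists_def)
  have single: "prob (Z i -` {s} \<inter> space M) = 1 / 4" if "s \<in> unit_steps" for i s
  proof -
    have "prob (Z i -` {s} \<inter> space M) = measure (distr M (count_space UNIV) (Z i)) {s}"
      using Z by (simp add: measure_distr)
    also have "\<dots> = 1 / 4"
      unfolding distr using that by (simp add: measure_pmf_single)
    finally show ?thesis .
  qed
  have "{\<omega> \<in> space M. map (\<lambda>i. X (Suc i) \<omega> - X i \<omega>) [0..<n] = ss} =
      (\<Inter>i\<in>{..<n}. Z i -` {ss ! i} \<inter> space M)"
    using len False by (auto simp: list_eq_iff_nth_eq Z_def)
  also have "prob \<dots> = (\<Prod>i\<in>{..<n}. prob (Z i -` {ss ! i} \<inter> space M))"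
    using indep False by (intro indep_varsD[where I = UNIV]) auto
  also have "\<dots> = (\<Prod>i\<in>{..<n}. 1 / 4)"
    using len by (intro prod.cong single) auto
  finally show ?thesis
    by simp
qed

text \<open>Almost surely the walk starts at \<open>v\<close> and has all increments in
  \<open>unit_steps\<close>. Up to a null set the event is thus the disjoint union, over the step
  lists satisfying \<open>hits\<close>, of the events in \<open>prob_increments\<close>.\<close>

lemma prob_hits:
  "prob {\<omega> \<in> space M. (\<forall>i<n. X i \<omega> \<in> F) \<and> X n \<omega> = e} = hit_weight F e n v"
proof -
  define Z where "Z = (\<lambda>\<omega>. map (\<lambda>i. X (Suc i) \<omega> - X i \<omega>) [0..<n])"
  have start: "AE \<omega> in M. X 0 \<omega> = v"
    using srw by (simp add: simple_random_walk_def)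
  have "AE \<omega> in M. X (Suc t) \<omega> - X t \<omega> \<in> unit_steps" for t
  proof -
    have "AE s in distr M (count_space UNIV) (\<lambda>\<omega>. X (Suc t) \<omega> - X t \<omega>). s \<in> unit_steps"
      unfolding distr_increment by (simp add: AE_measure_pmf_iff)
    then show ?thesis
      by (subst (asm) AE_distr_iff) auto
  qed
  then have steps: "AE \<omega> in M. \<forall>t. X (Suc t) \<omega> - X t \<omega> \<in> unit_steps"
    by (simp add: AE_all_countable)
  have Z: "{\<omega> \<in> space M. Z \<omega> = ss} \<in> sets M" for ss
  proof -
    have "Z \<omega> = ss \<longleftrightarrow> length ss = n \<and> (\<forall>i<n. X (Suc i) \<omega> - X i \<omega> = ss ! i)" for \<omega>
      by (auto simp: Z_def list_eq_iff_nth_eq)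
    then show ?thesis
      by simp
  qed
  have "prob {\<omega> \<in> space M. (\<forall>i<n. X i \<omega> \<in> F) \<and> X n \<omega> = e} =
      prob (\<Union>ss\<in>{ss \<in> step_lists n. hits F e v ss}. {\<omega> \<in> space M. Z \<omega> = ss})"
  proof (rule finite_measure_eq_AE)
    show "AE \<omega> in M. \<omega> \<in> {\<omega> \<in> space M. (\<forall>i<n. X i \<omega> \<in> F) \<and> X n \<omega> = e} \<longleftrightarrow>
        \<omega> \<in> (\<Union>ss\<in>{ss \<in> step_lists n. hits F e v ss}. {\<omega> \<in> space M. Z \<omega> = ss})"
      using start steps
    proof eventually_elim
      case (elim \<omega>)
      have "Z \<omega> \<in> step_lists n"
        using elim by (auto simp: Z_def step_lists_def)
      moreover have "hits F e v (Z \<omega>) \<longleftrightarrow> (\<forall>i<n. X i \<omega> \<in> F) \<and> X n \<omega> = e"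
        using hits_increments[of F e "\<lambda>i. X i \<omega>" 0 n] elim by (auto simp: Z_def)
      ultimately show ?case
        by auto
    qed
  qed (use Z finite_step_lists in \<open>auto intro!: sets.finite_UN\<close>)
  also have "\<dots> = (\<Sum>ss\<in>{ss \<in> step_lists n. hits F e v ss}. prob {\<omega> \<in> space M. Z \<omega> = ss})"
    using finite_step_lists Z
    by (intro finite_measure_finite_Union) (auto simp: disjoint_family_on_def)
  also have "\<dots> = (\<Sum>ss\<in>{ss \<in> step_lists n. hits F e v ss}. (1 / 4) ^ n)"
    by (intro sum.cong) (auto simp: Z_def prob_increments)
  also have "\<dots> = hit_weight F e n v"
    unfolding hit_weight_eq_sum using finite_step_lists
    by (intro sum.mono_neutral_cong_left) auto
  finally show ?thesis .
qed

text \<open>First reaching \<open>B\<close> alive at time \<open>t\<close> means staying in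
  \<open>\<Gamma> - B\<close> before \<open>t\<close>. As \<open>e \<in> B\<close>, the events for
  different \<open>t\<close> are disjoint, and their probabilities sum to the series.\<close>

lemma hit_prob_eq_exit_weight:
  assumes "e \<in> B" "B \<subseteq> \<Gamma>"
  shows "hit_prob M (killed_walk \<Gamma> X) B e = exit_weight (\<Gamma> - B) e v"
proof -
  define A where "A n = {\<omega> \<in> space M. (\<forall>i<n. X i \<omega> \<in> \<Gamma> - B) \<and> X n \<omega> = e}" for n
  have "hit_time (killed_walk \<Gamma> X) B \<omega> = enat t \<and> killed_walk \<Gamma> X t \<omega> = Some e \<longleftrightarrow>
      (\<forall>i<t. X i \<omega> \<in> \<Gamma> - B) \<and> X t \<omega> = e" for t \<omega>
    using assms by (auto simp: hit_time_eq_enat_iff killed_walk_def le_less split: if_splits)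
  then have "{\<omega> \<in> space M. \<exists>t. hit_time (killed_walk \<Gamma> X) B \<omega> = enat t \<and> killed_walk \<Gamma> X t \<omega> = Some e}
      = (\<Union>n. A n)"
    by (auto simp: A_def)
  moreover have "disjoint_family A"
    unfolding disjoint_family_on_def
  proof (intro ballI impI)
    fix i j :: nat assume "i \<noteq> j"
    then show "A i \<inter> A j = {}"
      using \<open>e \<in> B\<close> by (cases i j rule: linorder_cases) (auto simp: A_def)
  qed
  moreover have "range A \<subseteq> sets M"
    unfolding A_def by auto
  ultimately have "(\<lambda>n. prob (A n)) sums hit_prob M (killed_walk \<Gamma> X) B e"
    unfolding hit_prob_def using finite_measure_UNION[of A] by simp
  then show ?thesis
    unfolding A_def prob_hits exit_weight_def by (simp add: sums_iff)
qed

end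

theorem theorem1p1:
  fixes m a\<^sub>0 a\<^sub>1 b\<^sub>0 b\<^sub>1 :: int
    and \<eta>p \<eta>m :: "(int \<times> int) list"
    and C :: "(real \<times> real) set"
    and \<alpha> \<beta> \<Gamma> :: "(int \<times> int) set"
    and M :: "'a measure" and X :: "nat \<Rightarrow> 'a \<Rightarrow> int \<times> int"
    and p :: "int \<Rightarrow> real" and k :: int
  defines "C \<equiv> boundary_curve m a\<^sub>0 a\<^sub>1 b\<^sub>0 b\<^sub>1 \<eta>p \<eta>m"
    and "\<Gamma> \<equiv> lattice_region C"
    and "\<alpha> \<equiv> vertical_interval 0 a\<^sub>0 a\<^sub>1"
    and "\<beta> \<equiv> vertical_interval m b\<^sub>0 b\<^sub>1"
    and "p \<equiv> (\<lambda>j. hit_prob M (killed_walk \<Gamma> X) \<beta> (m, j))"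
  assumes "m > 0" and "a\<^sub>0 \<le> a\<^sub>1" and "b\<^sub>0 \<le> b\<^sub>1"
    and "lattice_path \<eta>p" and "x_monotone \<eta>p"
    and "hd \<eta>p = (0, a\<^sub>1)" and "last \<eta>p = (m, b\<^sub>1)"
    and "lattice_path \<eta>m" and "x_monotone \<eta>m"
    and "hd \<eta>m = (0, a\<^sub>0)" and "last \<eta>m = (m, b\<^sub>0)"
    and "simply_connected (C \<union> inside C)"
    and "{q \<in> \<Gamma>. fst q = m} = \<beta>"
    and "(0, 0) \<in> \<alpha>"
    and "simple_random_walk M (0, 0) X"
    and "(m, k + 1) \<in> \<beta>" and "(m, k - 1) \<in> \<beta>"
  shows "(p k)\<^sup>2 \<ge> p (k + 1) * p (k - 1)"
proof -
  define F where "F = \<Gamma> - \<beta>"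
  have ne: "\<eta>p \<noteq> []" "\<eta>m \<noteq> []"
    using assms(9,13) by (auto simp: lattice_path_def)
  note region = column_convex_lattice_region[OF assms(6-8) ne(1) assms(10-12) ne(2) assms(14-16),
      folded C_def, folded \<Gamma>_def]
  have "\<beta> \<subseteq> \<Gamma>"
    using assms(18) by blast
  \<comment> \<open>As \<beta> is the whole column \<open>m\<close> of \<Gamma>, removing it leaves
    the other columns intact, hence still intervals.\<close>
  have F_iff: "q \<in> F \<longleftrightarrow> q \<in> \<Gamma> \<and> fst q \<noteq> m" for q
    using assms(18) by (auto simp: F_def)
  have p: "p j = exit_weight F (m, j) (0, 0)" if "(m, j) \<in> \<beta>" for j
    unfolding p_def F_def using assms(20) that \<open>\<beta> \<subseteq> \<Gamma>\<close> by (rule hit_prob_eq_exit_weight)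
  \<comment> \<open>The identification of \<open>p\<close> with an exit weight holds on \<beta>,
    which as an interval contains the point between the two given ones.\<close>
  have "(m, k) \<in> \<beta>"
    using assms(21,22) by (auto simp: \<beta>_def vertical_interval_def)
  moreover have "exit_weight F (m, k + 1) (0, 0) * exit_weight F (m, k - 1) (0, 0)
      \<le> (exit_weight F (m, k) (0, 0))\<^sup>2"
  proof (rule exit_weight_log_concave)
    show "finite F"
      using region(1) by (simp add: F_def)
    show "fst ` F \<subseteq> {0..<m}"
      using region(2) by (force simp: F_iff)
    show "(0, 0) \<in> F"
      using region(4) assms(19) \<open>m > 0\<close> by (auto simp: F_iff \<alpha>_def)
    show "(x, w) \<in> F" if "(x, y) \<in> F" "(x, z) \<in> F" "y \<le> w" "w \<le> z" for x y z w
      using that region(3)[of x y z w] by (simp add: F_iff)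
  qed
  ultimately show ?thesis
    using assms(21,22) by (simp add: p)
qed

end
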